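(* Let $f$ be a ReLU-based MLP with $L$ hidden layers (layers indexed by $l\in\{1,\dots,L\}$) which takes $x\in\mathbb{R}^d$ as input and computes the output $y=H_L\,g(H_{L-1}\cdots g(H_1x))$, where $H_l\in\mathbb{R}^{n_l\times n_{l-1}}$ for $l\in\{1,\dots,L\}$ (with $n_0=d$) and $g$ is the ReLU function. Let $\left(\frac{\partial y}{\partial x}\right)_{(i,j)}$ denote the $(i,j)$ entry of the matrix $\frac{\partial y}{\partial x}$. Then the second-order derivatives of the MLP $f$ are $$\frac{\partial \left(\frac{\partial y}{\partial x}\right)_{(i,j)}}{\partial H_l}=\left(P_l^j S_l^i\right)^{T},\qquad \frac{\partial^2 y}{\partial x^2}=0,$$ where $P_l^j$ and $S_l^i$ are the column and row vectors defined in the context.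
   Context: ReLU: $g(t)=\max(t,0)$, applied entrywise to vectors. The MLP has weight matrices $H_1,\dots,H_L$ and no biases, and no activation is applied after the last matrix $H_L$. Activation masks: for $l\in\{2,\dots,L\}$, $G_l\in\mathbb{R}^{n_{l-1}\times n_{l-1}}$ is the diagonal 0/1 matrix whose $k$-th diagonal entry is $1$ if the $k$-th entry of $H_{l-1}g(H_{l-2}\cdots g(H_1x))$ is $>0$ (for $l=2$ this vector is $H_1x$), and $0$ otherwise. Let $H_1^{(\_,j)}$ be the $j$-th column of $H_1$ and $H_L^{(i,\_)}$ the $i$-th row of $H_L$. Define the column vector $P_l^j\in\mathbb{R}^{n_{l-1}\times 1}$ and the row vector $S_l^i\in\mathbb{R}^{1\times n_l}$ by $$P_l^j=G_lH_{l-1}\cdots G_2H_1^{(\_,j)},\qquad S_l^i=H_L^{(i,\_)}G_L\cdots H_{l+1}G_{l+1},$$ so that for instance $P_2^j=G_2H_1^{(\_,j)}$ and $S_{L-1}^i=H_L^{(i,\_)}G_L$. In the boundary cases, $P_1^j$ is read as the $j$-th standard basis column vector of $\mathbb{R}^{d}$ and $S_L^i$ as the $i$-th standard basis row vector of $\mathbb{R}^{n_L}$. Derivative conventions: $\frac{\partial y}{\partial x}$ is the $n_L\times d$ Jacobian matrix of $y$ with respect to $x$. For a scalar function $\varphi$ of the weights, $\frac{\partial \varphi}{\partial H_l}$ is the $n_l\times n_{l-1}$ matrix whose $(a,b)$ entry is the partial derivative of $\varphi$ with respect to the $(a,b)$ entry of $H_l$. $\frac{\partial^2 y}{\partial x^2}=0$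 means that all second partial derivatives of the entries of $y$ with respect to the coordinates of the input $x$ are zero.
   Formalization: The identities are proved where each hidden preactivation is nonzero, or is zero only because the whole previous hidden layer is inactive; without this they fail, e.g. y = g(x) has no derivative at x = 0. *)

theory Defs
  imports "HOL-Analysis.Derivative" "Jordan_Normal_Form.Matrix"
begin

definition relu :: "real \<Rightarrow> real" where
  "relu t = max t 0"

text \<open>A network is given by its weight matrices \<open>H 1, \<dots>, H L\<close>; the matrix \<open>H 0\<close> is never used.
  \<open>layer_out H x l\<close> is the vector fed into \<open>H (l + 1)\<close>, so \<open>layer_out H x 0\<close> is the input.\<close>

primrec layer_out :: "(nat \<Rightarrow> real mat) \<Rightarrow> real vec \<Rightarrow> nat \<Rightarrow> real vec" where
  "layer_out H x 0 = x"
| "layer_out H x (Suc l) = map_vec relu (H (Suc l) *\<^sub>v layer_out H x l)"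

definition preact :: "(nat \<Rightarrow> real mat) \<Rightarrow> real vec \<Rightarrow> nat \<Rightarrow> real vec" where
  "preact H x l = H l *\<^sub>v layer_out H x (l - 1)"

definition mlp :: "nat \<Rightarrow> (nat \<Rightarrow> real mat) \<Rightarrow> real vec \<Rightarrow> real vec" where
  "mlp L H x = H L *\<^sub>v layer_out H x (L - 1)"

definition relu_mask :: "(nat \<Rightarrow> real mat) \<Rightarrow> real vec \<Rightarrow> nat \<Rightarrow> real mat" where
  "relu_mask H x l = mat_diag (dim_vec (preact H x (l - 1)))
     (\<lambda>k. if preact H x (l - 1) $ k > 0 then 1 else 0)"

text \<open>The column vector \<open>P\<^sub>l\<^sup>j = G\<^sub>l H\<^sub>l\<^sub>-\<^sub>1 \<cdots> G\<^sub>2 H\<^sub>1\<^sup>(\<^sup>_\<^sup>,\<^sup>j\<^sup>)\<close> for \<open>l \<ge> 1\<close>, as a one-column matrix. Here and below,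
  indices start at 0, and the value at \<open>l = 0\<close> is irrelevant.\<close>

fun prefix_col :: "(nat \<Rightarrow> real mat) \<Rightarrow> real vec \<Rightarrow> nat \<Rightarrow> nat \<Rightarrow> real mat" where
  "prefix_col H x j 0 = undefined"
| "prefix_col H x j (Suc 0) = mat_of_cols (dim_vec x) [unit_vec (dim_vec x) j]"
| "prefix_col H x j (Suc (Suc 0)) =
     relu_mask H x 2 * mat_of_cols (dim_row (H 1)) [col (H 1) j]"
| "prefix_col H x j (Suc (Suc (Suc m))) =
     relu_mask H x (m + 3) * (H (m + 2) * prefix_col H x j (Suc (Suc m)))"

text \<open>\<open>suffix_row_aux L H x i m\<close> is the row vector \<open>S\<^sub>l\<^sup>i = H\<^sub>L\<^sup>(\<^sup>i\<^sup>,\<^sup>_\<^sup>) G\<^sub>L \<cdots> H\<^sub>l\<^sub>+\<^sub>1 G\<^sub>l\<^sub>+\<^sub>1\<close> for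
  \<open>l = L - m\<close>, as a one-row matrix.\<close>

fun suffix_row_aux :: "nat \<Rightarrow> (nat \<Rightarrow> real mat) \<Rightarrow> real vec \<Rightarrow> nat \<Rightarrow> nat \<Rightarrow> real mat" where
  "suffix_row_aux L H x i 0 = mat_of_row (unit_vec (dim_row (H L)) i)"
| "suffix_row_aux L H x i (Suc 0) = mat_of_row (row (H L) i) * relu_mask H x L"
| "suffix_row_aux L H x i (Suc (Suc m)) =
     suffix_row_aux L H x i (Suc m) * H (L - Suc m) * relu_mask H x (L - Suc m)"

definition suffix_row :: "nat \<Rightarrow> (nat \<Rightarrow> real mat) \<Rightarrow> real vec \<Rightarrow> nat \<Rightarrow> nat \<Rightarrow> real mat" where
  "suffix_row L H x i l = suffix_row_aux L H x i (L - l)"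

text \<open>Entries of \<open>jacobian\<close> are only meaningful at points where the partial derivatives exist,
  since \<open>deriv\<close> is total; \<open>has_partials\<close> states this existence.\<close>

definition has_partials :: "(real vec \<Rightarrow> real vec) \<Rightarrow> nat \<Rightarrow> real vec \<Rightarrow> bool" where
  "has_partials f m x \<longleftrightarrow> (\<forall>i<m. \<forall>j<dim_vec x.
     (\<lambda>t. f (update_vec x j t) $ i) differentiable at (x $ j))"

definition jacobian :: "(real vec \<Rightarrow> real vec) \<Rightarrow> nat \<Rightarrow> real vec \<Rightarrow> real mat" where
  "jacobian f m x = mat m (dim_vec x) (\<lambda>(i, j). deriv (\<lambda>t. f (update_vec x j t) $ i) (x $ j))"

definition has_mat_partials :: "(real mat \<Rightarrow> real) \<Rightarrow> real mat \<Rightarrow> real mat \<Rightarrow> bool" where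
  "has_mat_partials \<phi> D A \<longleftrightarrow> D \<in> carrier_mat (dim_row A) (dim_col A) \<and>
     (\<forall>a<dim_row A. \<forall>b<dim_col A.
       ((\<lambda>t. \<phi> (update_mat A (a, b) t)) has_real_derivative D $$ (a, b)) (at (A $$ (a, b))))"

text \<open>The derivatives of a ReLU network need not exist where a hidden unit sits at the kink of the
  ReLU. A unit of layer \<open>l\<close> with preactivation 0 is harmless only if all units of layer
  \<open>l - 1\<close> are inactive: inductively, its preactivation then stays 0 near \<open>(H, x)\<close>. Thus this condition
  describes the points around which all activation masks are constant in weights and input.\<close>

definition off_kinks :: "nat \<Rightarrow> (nat \<Rightarrow> real mat) \<Rightarrow> real vec \<Rightarrow> bool" where
  "off_kinks L H x \<longleftrightarrow> (\<forall>l\<in>{1..<L}. \<forall>k<dim_vec (preact H x l).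
     preact H x l $ k \<noteq> 0 \<or>
     (l \<ge> 2 \<and> (\<forall>q<dim_vec (layer_out H x (l - 1)). layer_out H x (l - 1) $ q = 0)))"

end

theory Submission
  imports Defs
begin

text \<open>Off the kinks, every one-parameter perturbation of weights or input keeps all activation masks
  constant near the base point. With frozen masks \<open>G\<close> the network is the linear map
  \<open>H\<^sub>L G\<^sub>L H\<^sub>L\<^sub>-\<^sub>1 \<cdots> G\<^sub>2 H\<^sub>1\<close>, which is therefore its Jacobian. It does not depend on the input, and
  its \<open>(i, j)\<close> entry is \<open>S\<^sub>l\<^sup>i H\<^sub>l P\<^sub>l\<^sup>j\<close>, where neither \<open>S\<^sub>l\<^sup>i\<close> nor \<open>P\<^sub>l\<^sup>j\<close> involves \<open>H\<^sub>l\<close>; so its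
  derivative in the \<open>(a, b)\<close> entry of \<open>H\<^sub>l\<close> is the product of entry \<open>a\<close> of \<open>S\<^sub>l\<^sup>i\<close> and entry \<open>b\<close>
  of \<open>P\<^sub>l\<^sup>j\<close>.\<close>

section \<open>Dimension conditions and matrix products with frozen masks\<close>

definition layer_dims :: "nat \<Rightarrow> (nat \<Rightarrow> nat) \<Rightarrow> (nat \<Rightarrow> real mat) \<Rightarrow> bool" where
  "layer_dims L n H \<longleftrightarrow> (\<forall>l\<in>{1..L}. H l \<in> carrier_mat (n l) (n (l - 1)))"

definition mask_dims :: "nat \<Rightarrow> (nat \<Rightarrow> nat) \<Rightarrow> (nat \<Rightarrow> real mat) \<Rightarrow> bool" where
  "mask_dims L n G \<longleftrightarrow> (\<forall>l\<in>{2..L}. G l \<in> carrier_mat (n (l - 1)) (n (l - 1)))"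

text \<open>Lets \<open>G\<close> be the masks of one base point while \<open>H\<close> and
  \<open>x\<close> are perturbed. Indices start at 2 because mask \<open>l\<close> acts on the
  output of layer \<open>l - 1\<close>.\<close>

definition same_masks :: "nat \<Rightarrow> (nat \<Rightarrow> real mat) \<Rightarrow> real vec \<Rightarrow> (nat \<Rightarrow> real mat) \<Rightarrow> bool" where
  "same_masks L H x G \<longleftrightarrow> (\<forall>l\<in>{2..L}. relu_mask H x l = G l)"

text \<open>The masks \<open>G\<close> are separate from the weights \<open>H\<close>, so that the weights can vary while the masks stay
  fixed. Column \<open>j\<close> of \<open>lower_prod G H d m\<close> is \<open>P\<^sub>m\<^sub>+\<^sub>1\<^sup>j\<close>, and \<open>upper_row L N G H i m\<close> is \<open>S\<^sub>L\<^sub>-\<^sub>m\<^sup>i\<close>.\<close>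

primrec lower_prod :: "(nat \<Rightarrow> real mat) \<Rightarrow> (nat \<Rightarrow> real mat) \<Rightarrow> nat \<Rightarrow> nat \<Rightarrow> real mat" where
  "lower_prod G H d 0 = 1\<^sub>m d"
| "lower_prod G H d (Suc m) = G (m + 2) * (H (Suc m) * lower_prod G H d m)"

primrec upper_row ::
  "nat \<Rightarrow> nat \<Rightarrow> (nat \<Rightarrow> real mat) \<Rightarrow> (nat \<Rightarrow> real mat) \<Rightarrow> nat \<Rightarrow> nat \<Rightarrow> real mat" where
  "upper_row L N G H i 0 = mat_of_row (unit_vec N i)"
| "upper_row L N G H i (Suc m) = upper_row L N G H i m * H (L - m) * G (L - m)"

lemma layer_dimsD: "layer_dims L n H \<Longrightarrow> 1 \<le> l \<Longrightarrow> l \<le> L \<Longrightarrow> H l \<in> carrier_mat (n l) (n (l - 1))"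
  by (simp add: layer_dims_def)

lemma mask_dimsD:
  "mask_dims L n G \<Longrightarrow> 2 \<le> l \<Longrightarrow> l \<le> L \<Longrightarrow> G l \<in> carrier_mat (n (l - 1)) (n (l - 1))"
  by (simp add: mask_dims_def)

lemma layer_dims_update:
  assumes "layer_dims L n H"
  shows "layer_dims L n (H(l := update_mat (H l) (a, b) t))"
  unfolding layer_dims_def
proof
  fix k assume "k \<in> {1..L}"
  then have H: "H k \<in> carrier_mat (n k) (n (k - 1))"
    by (intro layer_dimsD[OF assms]) auto
  have "update_mat (H k) (a, b) t \<in> carrier_mat (n k) (n (k - 1))"
    using carrier_matD[OF H] by (intro carrier_matI) (simp_all only: dim_update_mat)
  with H show "(H(l := update_mat (H l) (a, b) t)) k \<in> carrier_mat (n k) (n (k - 1))"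
    by (cases "k = l") (simp_all only: fun_upd_same fun_upd_other not_False_eq_True)
qed

section \<open>Entries of layers and preactivations, and ReLU as a diagonal matrix\<close>

lemma mult_mat_vec_index:
  fixes A :: "'a :: semiring_0 mat"
  assumes "A \<in> carrier_mat r c" "v \<in> carrier_vec c" "i < r"
  shows "(A *\<^sub>v v) $ i = (\<Sum>k<c. A $$ (i, k) * v $ k)"
  using assms by (simp add: scalar_prod_def lessThan_atLeast0)

lemma layer_out_carrier:
  assumes "layer_dims L n H" "x \<in> carrier_vec (n 0)" "l \<le> L"
  shows "layer_out H x l \<in> carrier_vec (n l)"
proof (cases l)
  case (Suc m)
  then have "dim_row (H (Suc m)) = n (Suc m)"
    using carrier_matD(1)[OF layer_dimsD[OF assms(1), of l]] assms(3) by simp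
  then show ?thesis using Suc by (intro carrier_vecI) simp
qed (use assms in simp)

lemma preact_carrier:
  assumes "layer_dims L n H" "1 \<le> l" "l \<le> L"
  shows "preact H x l \<in> carrier_vec (n l)"
  using carrier_matD(1)[OF layer_dimsD[OF assms]] by (intro carrier_vecI) (simp add: preact_def)

lemma layer_out_relu_preact: "1 \<le> l \<Longrightarrow> layer_out H x l = map_vec relu (preact H x l)"
  by (cases l) (auto simp: preact_def)

lemma preact_index:
  assumes "layer_dims L n H" "x \<in> carrier_vec (n 0)" "1 \<le> l" "l \<le> L" "k < n l"
  shows "preact H x l $ k = (\<Sum>q<n (l - 1). H l $$ (k, q) * layer_out H x (l - 1) $ q)"
  using carrier_matD[OF layer_dimsD[OF assms(1,3,4)]] assms(4,5)
    carrier_vecD[OF layer_out_carrier[OF assms(1,2), of "l - 1"]]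
  by (simp add: preact_def scalar_prod_def lessThan_atLeast0)

lemma layer_out_index:
  assumes "layer_dims L n H" "1 \<le> l" "l \<le> L" "k < n l"
  shows "layer_out H x l $ k = relu (preact H x l $ k)"
  using preact_carrier[OF assms(1-3), of x] assms(2,4) by (auto simp: layer_out_relu_preact)

text \<open>Whether a unit is inactive depends only on the sign of its preactivation; the stability
  argument below therefore tracks signs.\<close>

lemma relu_eq_0_iff: "relu v = 0 \<longleftrightarrow> sgn v \<noteq> 1"
  by (auto simp: relu_def max_def sgn_if)

text \<open>In each coordinate ReLU multiplies by 1 or by 0 according to the sign, so at the point
  itself the nonlinearity is a matrix.\<close>

lemma relu_mask_preact:
  assumes "preact H x (l - 1) \<in> carrier_vec m"
  shows "relu_mask H x l *\<^sub>v preact H x (l - 1) = map_vec relu (preact H x (l - 1))"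
  using assms
  by (intro eq_vecI) (auto simp: relu_mask_def mat_diag_def scalar_prod_def relu_def
      if_distrib[of "\<lambda>c. c * _"] sum.delta cong: if_cong)

lemma relu_mask_dims:
  assumes "layer_dims L n H"
  shows "mask_dims L n (relu_mask H x)"
  unfolding mask_dims_def
proof
  fix l assume "l \<in> {2..L}"
  then have "dim_vec (preact H x (l - 1)) = n (l - 1)"
    by (intro carrier_vecD preact_carrier[OF assms]) auto
  then show "relu_mask H x l \<in> carrier_mat (n (l - 1)) (n (l - 1))"
    by (simp add: relu_mask_def)
qed

section \<open>The network as a product of matrices\<close>

lemma lower_prod_carrier:
  assumes "layer_dims L n H" "mask_dims L n G" "m < L"
  shows "lower_prod G H (n 0) m \<in> carrier_mat (n m) (n 0)"
  using assms(3)
proof (induction m)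
  case (Suc m)
  have A: "H (Suc m) \<in> carrier_mat (n (Suc m)) (n m)"
    using layer_dimsD[OF assms(1), of "Suc m"] Suc by simp
  have G: "G (m + 2) \<in> carrier_mat (n (Suc m)) (n (Suc m))"
    using mask_dimsD[OF assms(2), of "m + 2"] Suc by simp
  have C: "lower_prod G H (n 0) m \<in> carrier_mat (n m) (n 0)" using Suc by simp
  show ?case
    unfolding lower_prod.simps by (rule mult_carrier_mat[OF G mult_carrier_mat[OF A C]])
qed simp

lemma upper_row_carrier:
  assumes "layer_dims L n H" "mask_dims L n G" "m < L"
  shows "upper_row L (n L) G H i m \<in> carrier_mat 1 (n (L - m))"
  using assms(3)
proof (induction m)
  case (Suc m)
  have U: "upper_row L (n L) G H i m \<in> carrier_mat 1 (n (L - m))" using Suc by simp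
  have A: "H (L - m) \<in> carrier_mat (n (L - m)) (n (L - Suc m))"
    using layer_dimsD[OF assms(1), of "L - m"] Suc by simp
  have B: "G (L - m) \<in> carrier_mat (n (L - Suc m)) (n (L - Suc m))"
    using mask_dimsD[OF assms(2), of "L - m"] Suc by simp
  show ?case
    unfolding upper_row.simps by (rule mult_carrier_mat[OF mult_carrier_mat[OF U A] B])
qed auto

text \<open>Induction over the layers, replacing each ReLU by its mask; the output of layer
  \<open>Suc m\<close> is masked by \<open>G (m + 2)\<close>.\<close>

lemma layer_out_eq_lower_prod:
  assumes "layer_dims L n H" "same_masks L H x G" "x \<in> carrier_vec (n 0)" "m < L"
  shows "layer_out H x m = lower_prod G H (n 0) m *\<^sub>v x"
  using assms(4)
proof (induction m)
  case (Suc m)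
  have GD: "mask_dims L n G"
    using relu_mask_dims[OF assms(1), of x] assms(2) by (simp add: mask_dims_def same_masks_def)
  have G: "G (m + 2) \<in> carrier_mat (n (Suc m)) (n (Suc m))"
    using mask_dimsD[OF GD, of "m + 2"] Suc by simp
  have Hm: "H (Suc m) \<in> carrier_mat (n (Suc m)) (n m)"
    using layer_dimsD[OF assms(1), of "Suc m"] Suc by simp
  have C: "lower_prod G H (n 0) m \<in> carrier_mat (n m) (n 0)"
    using lower_prod_carrier[OF assms(1) GD] Suc by simp
  have "layer_out H x (Suc m) = relu_mask H x (m + 2) *\<^sub>v preact H x (Suc m)"
    using relu_mask_preact[of H x "m + 2" "n (Suc m)"] preact_carrier[OF assms(1), of "Suc m" x] Suc
    by (simp add: preact_def)
  also have "relu_mask H x (m + 2) = G (m + 2)"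
    using assms(2) Suc by (simp add: same_masks_def)
  also have "preact H x (Suc m) = H (Suc m) *\<^sub>v (lower_prod G H (n 0) m *\<^sub>v x)"
    using Suc by (simp add: preact_def)
  finally show ?case
    using G Hm C assms(3)
    by (simp add: assoc_mult_mat_vec[of _ "n (Suc m)" "n (Suc m)" _ "n 0"]
        assoc_mult_mat_vec[of _ "n (Suc m)" "n m" _ "n 0"])
qed (use assms in auto)

lemma mlp_eq_lower_prod:
  assumes "layer_dims L n H" "same_masks L H x G" "x \<in> carrier_vec (n 0)" "1 \<le> L"
  shows "mlp L H x = (H L * lower_prod G H (n 0) (L - 1)) *\<^sub>v x"
proof -
  have GD: "mask_dims L n G"
    using relu_mask_dims[OF assms(1), of x] assms(2) by (simp add: mask_dims_def same_masks_def)
  have HL: "H L \<in> carrier_mat (n L) (n (L - 1))"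
    using layer_dimsD[OF assms(1) assms(4)] by simp
  have C: "lower_prod G H (n 0) (L - 1) \<in> carrier_mat (n (L - 1)) (n 0)"
    using lower_prod_carrier[OF assms(1) GD] assms(4) by simp
  have "layer_out H x (L - 1) = lower_prod G H (n 0) (L - 1) *\<^sub>v x"
    using layer_out_eq_lower_prod[OF assms(1-3)] assms(4) by simp
  then show ?thesis
    unfolding mlp_def using assoc_mult_mat_vec[OF HL C assms(3)] by simp
qed

text \<open>Associativity: passing from \<open>m\<close> to \<open>Suc m\<close> moves one mask and
  one weight matrix from the right factor to the left, so \<open>S_l H_l P_l\<close> is the same for
  every cutting point \<open>l\<close>.\<close>

lemma upper_row_mult:
  assumes "layer_dims L n H" "mask_dims L n G" "m < L"
  shows "upper_row L (n L) G H i m * H (L - m) * lower_prod G H (n 0) (L - m - 1) =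
    mat_of_row (unit_vec (n L) i) * H L * lower_prod G H (n 0) (L - 1)"
  using assms(3)
proof (induction m)
  case (Suc m)
  let ?l = "L - Suc m"
  let ?U = "upper_row L (n L) G H i m" and ?C = "lower_prod G H (n 0) (L - m - 2)"
  have U: "?U \<in> carrier_mat 1 (n (L - m))" using upper_row_carrier[OF assms(1,2)] Suc by simp
  have A: "H (L - m) \<in> carrier_mat (n (L - m)) (n ?l)"
    using layer_dimsD[OF assms(1), of "L - m"] Suc by simp
  have G: "G (L - m) \<in> carrier_mat (n ?l) (n ?l)"
    using mask_dimsD[OF assms(2), of "L - m"] Suc by simp
  have B: "H ?l \<in> carrier_mat (n ?l) (n (L - m - 2))"
    using layer_dimsD[OF assms(1), of ?l] Suc by (simp add: numeral_2_eq_2)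
  have C: "?C \<in> carrier_mat (n (L - m - 2)) (n 0)"
    using lower_prod_carrier[OF assms(1,2)] Suc by simp
  \<comment> \<open>Subtraction truncates at 0; \<open>Suc m < L\<close> makes these identities
    valid.\<close>
  have eq: "L - m - 1 = Suc (L - m - 2)" "Suc (L - m - 2) = ?l" "L - m - 2 + 2 = L - m"
    "?l - 1 = L - m - 2"
    using Suc by auto
  have UA: "?U * H (L - m) \<in> carrier_mat 1 (n ?l)" using U A by simp
  have BC: "H ?l * ?C \<in> carrier_mat (n ?l) (n 0)" using B C by simp
  have "upper_row L (n L) G H i (Suc m) * H ?l * lower_prod G H (n 0) (?l - 1) =
      ?U * H (L - m) * G (L - m) * H ?l * ?C"
    by (simp only: eq(4) upper_row.simps)
  also have "\<dots> = ?U * H (L - m) * (G (L - m) * (H ?l * ?C))"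
    using assoc_mult_mat[OF mult_carrier_mat[OF UA G] B C] assoc_mult_mat[OF UA G BC] by simp
  \<comment> \<open>The regrouped factor is the lower product one layer higher, which is the form of
    the induction hypothesis.\<close>
  also have "G (L - m) * (H ?l * ?C) = lower_prod G H (n 0) (Suc (L - m - 2))"
    using lower_prod.simps(2)[of G H "n 0" "L - m - 2"] by (simp only: eq(2,3))
  also have "Suc (L - m - 2) = L - m - 1"
    by (simp only: eq(1))
  finally show ?case using Suc by simp
qed simp

text \<open>The double sum exposes the dependence on \<open>H l\<close>: it is linear in the entries
  of that matrix, with coefficients built from the other layers, and can be differentiated term by
  term.\<close>

lemma upper_row_mult_index:
  assumes "layer_dims L n H" "mask_dims L n G" "1 \<le> l" "l \<le> L" "i < n L" "j < n 0"
  shows "(H L * lower_prod G H (n 0) (L - 1)) $$ (i, j) =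
    (\<Sum>b<n (l - 1). (\<Sum>a<n l. upper_row L (n L) G H i (L - l) $$ (0, a) * H l $$ (a, b))
      * lower_prod G H (n 0) (l - 1) $$ (b, j))"
proof -
  let ?C = "lower_prod G H (n 0) (L - 1)"
  have HL: "H L \<in> carrier_mat (n L) (n (L - 1))"
    using layer_dimsD[OF assms(1), of L] assms by simp
  have C: "?C \<in> carrier_mat (n (L - 1)) (n 0)"
    using lower_prod_carrier[OF assms(1,2)] assms by simp
  have U: "upper_row L (n L) G H i (L - l) \<in> carrier_mat 1 (n l)"
    using upper_row_carrier[OF assms(1,2), of "L - l"] assms by simp
  have Hl: "H l \<in> carrier_mat (n l) (n (l - 1))"
    using layer_dimsD[OF assms(1)] assms by simp
  have C': "lower_prod G H (n 0) (l - 1) \<in> carrier_mat (n (l - 1)) (n 0)"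
    using lower_prod_carrier[OF assms(1,2)] assms by simp
  have E: "mat_of_row (unit_vec (n L) i) \<in> carrier_mat 1 (n L)" by auto
  have "mat_of_row (unit_vec (n L) i) * H L * ?C = mat_of_row (unit_vec (n L) i) * (H L * ?C)"
    by (rule assoc_mult_mat[OF E HL C])
  also have "\<dots> $$ (0, j) = (H L * ?C) $$ (i, j)"
    using HL C assms E by (simp add: scalar_prod_left_unit[of _ "n L"] del: assoc_mult_mat)
  finally have "(H L * ?C) $$ (i, j) =
      (upper_row L (n L) G H i (L - l) * H l * lower_prod G H (n 0) (l - 1)) $$ (0, j)"
    using upper_row_mult[OF assms(1,2), of "L - l" i] assms by simp
  also have "\<dots> = (\<Sum>b<n (l - 1). (\<Sum>a<n l. upper_row L (n L) G H i (L - l) $$ (0, a) * H l $$ (a, b))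
      * lower_prod G H (n 0) (l - 1) $$ (b, j))"
    using U Hl C' assms by (simp add: scalar_prod_def lessThan_atLeast0 del: assoc_mult_mat)
  finally show ?thesis .
qed

section \<open>Independence from \<open>H l\<close>, and identification with the vectors
  \<open>P\<close> and \<open>S\<close>\<close>

lemma lower_prod_cong:
  assumes "\<And>k. 1 \<le> k \<Longrightarrow> k \<le> m \<Longrightarrow> H k = H' k"
  shows "lower_prod G H d m = lower_prod G H' d m"
  using assms by (induction m) auto

text \<open>With \<open>m = L - l\<close> only matrices above layer \<open>l\<close> enter, just as
  \<open>lower_prod_cong\<close> with \<open>m = l - 1\<close> involves only those below; both
  factors thus survive a change of \<open>H l\<close>.\<close>

lemma upper_row_cong:
  assumes "\<And>k. L - m < k \<Longrightarrow> k \<le> L \<Longrightarrow> H k = H' k" "m \<le> L"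
  shows "upper_row L N G H i m = upper_row L N G H' i m"
  using assms by (induction m) auto

text \<open>Multiplying by a basis column selects column \<open>j\<close>, and by associativity this
  can be done before or after the layers are multiplied.\<close>

lemma prefix_col_eq:
  assumes "layer_dims L n H" "x \<in> carrier_vec (n 0)" "m < L" "j < n 0"
  shows "prefix_col H x j (Suc m) =
    lower_prod (relu_mask H x) H (n 0) m * mat_of_cols (n 0) [unit_vec (n 0) j]"
  using assms(3)
proof (induction m)
  case 0
  then show ?case using assms(2) by simp
next
  case (Suc m)
  let ?E = "mat_of_cols (n 0) [unit_vec (n 0) j] :: real mat"
  let ?C = "lower_prod (relu_mask H x) H (n 0) m"
  have E: "?E \<in> carrier_mat (n 0) 1" using mat_of_cols_carrier(1)[of "n 0" "[unit_vec (n 0) j]"] by simp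
  have G: "relu_mask H x (m + 2) \<in> carrier_mat (n (Suc m)) (n (Suc m))"
    using mask_dimsD[OF relu_mask_dims[OF assms(1)], of "m + 2"] Suc by simp
  have Hm: "H (Suc m) \<in> carrier_mat (n (Suc m)) (n m)"
    using layer_dimsD[OF assms(1), of "Suc m"] Suc by simp
  have C: "?C \<in> carrier_mat (n m) (n 0)"
    using lower_prod_carrier[OF assms(1) relu_mask_dims[OF assms(1)]] Suc by simp
  have "prefix_col H x j (Suc (Suc m)) = relu_mask H x (m + 2) * (H (Suc m) * (?C * ?E))"
  \<comment> \<open>\<open>prefix_col\<close> has a separate clause at index 2, starting from a
    column of \<open>H 1\<close>; that column is \<open>H 1\<close> times the basis vector.\<close>
  proof (cases m)
    case 0
    have "mat_of_cols (dim_row (H 1)) [col (H 1) j] = H 1 * ?E"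
      using Hm 0 assms(4) by (intro eq_matI) (auto simp: mat_of_cols_index)
    then show ?thesis using 0 E by (simp add: numeral_2_eq_2)
  next
    case (Suc k)
    then show ?thesis using Suc.IH Suc.prems by (simp add: numeral_3_eq_3)
  qed
  then show ?case
    using assoc_mult_mat[OF Hm C E] assoc_mult_mat[OF G mult_carrier_mat[OF Hm C] E] by simp
qed

lemma prefix_col_index:
  assumes "layer_dims L n H" "x \<in> carrier_vec (n 0)" "1 \<le> l" "l \<le> L" "j < n 0"
  shows "prefix_col H x j l \<in> carrier_mat (n (l - 1)) 1"
    and "b < n (l - 1) \<Longrightarrow>
      prefix_col H x j l $$ (b, 0) = lower_prod (relu_mask H x) H (n 0) (l - 1) $$ (b, j)"
proof -
  have C: "lower_prod (relu_mask H x) H (n 0) (l - 1) \<in> carrier_mat (n (l - 1)) (n 0)"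
    using lower_prod_carrier[OF assms(1) relu_mask_dims[OF assms(1)]] assms by simp
  have eq: "prefix_col H x j l =
      lower_prod (relu_mask H x) H (n 0) (l - 1) * mat_of_cols (n 0) [unit_vec (n 0) j]"
    using prefix_col_eq[OF assms(1,2), of "l - 1" j] assms by simp
  show "prefix_col H x j l \<in> carrier_mat (n (l - 1)) 1"
    unfolding eq using C by auto
  show "prefix_col H x j l $$ (b, 0) = lower_prod (relu_mask H x) H (n 0) (l - 1) $$ (b, j)"
    if "b < n (l - 1)"
    unfolding eq using C that assms by (simp add: scalar_prod_right_unit[of _ "n 0"])
qed

text \<open>Row \<open>i\<close> of \<open>H L\<close> is the basis row times \<open>H L\<close>, so
  the special clause of \<open>suffix_row_aux\<close> at \<open>Suc 0\<close> fits the uniform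
  recursion of \<open>upper_row\<close>.\<close>

lemma suffix_row_eq:
  assumes "layer_dims L n H" "1 \<le> l" "l \<le> L" "i < n L"
  shows "suffix_row L H x i l = upper_row L (n L) (relu_mask H x) H i (L - l)"
proof -
  have HL: "H L \<in> carrier_mat (n L) (n (L - 1))"
    using layer_dimsD[OF assms(1), of L] assms by simp
  then have row: "mat_of_row (unit_vec (n L) i) * H L = mat_of_row (row (H L) i)"
    using assms(4) by (intro eq_matI) auto
  have "suffix_row_aux L H x i m = upper_row L (n L) (relu_mask H x) H i m" for m
  proof (induction m)
    case (Suc m)
    then show ?case using HL row by (cases m) auto
  qed (use HL in auto)
  then show ?thesis by (simp add: suffix_row_def)
qed

section \<open>Stability of the masks under perturbation\<close>

text \<open>A unit at a kink contributes nothing that moves: its preactivation stays 0 because all its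
  inputs stay inactive. All other preactivations keep their signs by continuity.\<close>

lemma off_kinks_stable:
  fixes F :: "'a filter" and H :: "nat \<Rightarrow> real mat" and H' :: "'a \<Rightarrow> nat \<Rightarrow> real mat"
    and x :: "real vec" and x' :: "'a \<Rightarrow> real vec"
  assumes H: "layer_dims L n H" "x \<in> carrier_vec (n 0)" "off_kinks L H x"
    and H': "\<And>t. layer_dims L n (H' t)" "\<And>t. x' t \<in> carrier_vec (n 0)"
    and limH: "\<And>l a b. 1 \<le> l \<Longrightarrow> l \<le> L \<Longrightarrow> a < n l \<Longrightarrow> b < n (l - 1) \<Longrightarrow>
      ((\<lambda>t. H' t l $$ (a, b)) \<longlongrightarrow> H l $$ (a, b)) F"
    and limx: "\<And>k. k < n 0 \<Longrightarrow> ((\<lambda>t. x' t $ k) \<longlongrightarrow> x $ k) F"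
  shows "\<forall>\<^sub>F t in F. off_kinks L (H' t) (x' t) \<and> same_masks L (H' t) (x' t) (relu_mask H x)"
proof -
  \<comment> \<open>Continuity of every layer in weights and input jointly, since only sums,
    products and maxima occur.\<close>
  have lim_out: "((\<lambda>t. layer_out (H' t) (x' t) l $ k) \<longlongrightarrow> layer_out H x l $ k) F"
    if "l \<le> L" "k < n l" for l k
    using that
  proof (induction l arbitrary: k)
    case 0
    then show ?case using limx by simp
  next
    case (Suc l)
    have "((\<lambda>t. preact (H' t) (x' t) (Suc l) $ k) \<longlongrightarrow> preact H x (Suc l) $ k) F"
      using Suc by (simp add: preact_index[OF H(1,2)] preact_index[OF H'])
        (intro tendsto_sum tendsto_mult Suc.IH limH, auto)
    then show ?case
      using Suc.prems
      by (simp add: layer_out_index[OF H(1)] layer_out_index[OF H'(1)] relu_def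
          del: layer_out.simps) (intro tendsto_max tendsto_const)
  qed
  have lim_pre: "((\<lambda>t. preact (H' t) (x' t) l $ k) \<longlongrightarrow> preact H x l $ k) F"
    if "1 \<le> l" "l \<le> L" "k < n l" for l k
    using that by (simp add: preact_index[OF H(1,2)] preact_index[OF H'])
      (intro tendsto_sum tendsto_mult lim_out limH, auto)
  \<comment> \<open>Invariant of the induction over layers: equal signs fix the masks and pass
    inactivity upwards, while the second conjunct is the \<open>off_kinks\<close> condition at the
    perturbed point.\<close>
  define ok where "ok t l k \<longleftrightarrow>
      sgn (preact (H' t) (x' t) l $ k) = sgn (preact H x l $ k) \<and>
      (preact (H' t) (x' t) l $ k \<noteq> 0 \<or>
        (2 \<le> l \<and> (\<forall>q<n (l - 1). layer_out (H' t) (x' t) (l - 1) $ q = 0)))" for t l k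
  have ok: "\<forall>\<^sub>F t in F. \<forall>k<n l. ok t l k" if "1 \<le> l" "l < L" for l
    using that
  proof (induction l)
    case (Suc l)
    have "\<forall>\<^sub>F t in F. ok t (Suc l) k" if k: "k < n (Suc l)" for k
    proof (cases "preact H x (Suc l) $ k = 0")
      \<comment> \<open>Away from 0 the limit eventually forces the sign.\<close>
      case False
      have lim: "((\<lambda>t. preact (H' t) (x' t) (Suc l) $ k) \<longlongrightarrow> preact H x (Suc l) $ k) F"
        using lim_pre[of "Suc l" k] k Suc.prems by simp
      have "\<forall>\<^sub>F t in F. sgn (preact (H' t) (x' t) (Suc l) $ k) = sgn (preact H x (Suc l) $ k)"
      proof (cases "preact H x (Suc l) $ k > 0")
        case True
        show ?thesis
          by (rule eventually_mono[OF order_tendstoD(1)[OF lim True]]) (use True in simp)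
      next
        case neg: False
        then have "preact H x (Suc l) $ k < 0" using False by simp
        from this order_tendstoD(2)[OF lim this] show ?thesis
          by (auto elim: eventually_mono)
      qed
      then show ?thesis
        by (rule eventually_mono) (use False in \<open>auto simp: ok_def sgn_if split: if_splits\<close>)
    next
      \<comment> \<open>At a kink, \<open>off_kinks\<close> provides an inactive layer below. The
        induction hypothesis keeps it inactive, so the preactivation stays exactly 0, which
        continuity alone could not give.\<close>
      case True
      have dimk: "k < dim_vec (preact H x (Suc l))"
        using preact_carrier[OF H(1), of "Suc l" x] k Suc.prems by simp
      have l: "1 \<le> l" and zero: "\<And>q. q < n l \<Longrightarrow> layer_out H x l $ q = 0"
        using H(3) True dimk Suc.prems layer_out_carrier[OF H(1,2), of l]
        unfolding off_kinks_def by (fastforce simp del: layer_out.simps)+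
      have "\<forall>\<^sub>F t in F. \<forall>q<n l. ok t l q" using Suc l by simp
      then show ?thesis
      proof (rule eventually_mono)
        fix t assume t: "\<forall>q<n l. ok t l q"
        have zero': "layer_out (H' t) (x' t) l $ q = 0" if q: "q < n l" for q
        proof -
          have "relu (preact H x l $ q) = 0"
            using zero[OF q] layer_out_index[OF H(1) l _ q] Suc.prems by simp
          then have "relu (preact (H' t) (x' t) l $ q) = 0"
            using t q by (simp add: relu_eq_0_iff ok_def)
          then show ?thesis using layer_out_index[OF H'(1) l _ q] Suc.prems by simp
        qed
        then have "preact (H' t) (x' t) (Suc l) $ k = 0"
          using preact_index[OF H', of "Suc l" k] k Suc.prems by simp
        then show "ok t (Suc l) k" using True zero' l by (simp add: ok_def)
      qed
    qed
    \<comment> \<open>A layer has finitely many units, so one neighbourhood serves them all.\<close>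
    then have "\<forall>\<^sub>F t in F. \<forall>k\<in>{..<n (Suc l)}. ok t (Suc l) k"
      by (intro eventually_ball_finite) auto
    then show ?case by (rule eventually_mono) auto
  qed simp
  then have "\<forall>\<^sub>F t in F. \<forall>l\<in>{1..<L}. \<forall>k<n l. ok t l k"
    by (intro eventually_ball_finite) auto
  then show ?thesis
  proof (rule eventually_mono)
    fix t assume t: "\<forall>l\<in>{1..<L}. \<forall>k<n l. ok t l k"
    have "off_kinks L (H' t) (x' t)"
      unfolding off_kinks_def
    proof (intro ballI allI impI)
      fix l k assume l: "l \<in> {1..<L}" and "k < dim_vec (preact (H' t) (x' t) l)"
      then have "ok t l k" using t preact_carrier[OF H'(1)[of t], of l "x' t"] by simp
      moreover have "dim_vec (layer_out (H' t) (x' t) (l - 1)) = n (l - 1)"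
        by (rule carrier_vecD[OF layer_out_carrier[OF H']]) (use l in auto)
      ultimately show "preact (H' t) (x' t) l $ k \<noteq> 0 \<or> 2 \<le> l \<and>
          (\<forall>q<dim_vec (layer_out (H' t) (x' t) (l - 1)). layer_out (H' t) (x' t) (l - 1) $ q = 0)"
        by (simp add: ok_def)
    qed
    moreover have "relu_mask (H' t) (x' t) l = relu_mask H x l" if l: "l \<in> {2..L}" for l
    proof -
      have "(preact (H' t) (x' t) (l - 1) $ k > 0) = (preact H x (l - 1) $ k > 0)"
        if "k < n (l - 1)" for k
      proof -
        have "l - 1 \<in> {1..<L}" using l by auto
        with t that have "ok t (l - 1) k" by blast
        then show ?thesis unfolding ok_def by (metis sgn_greater)
      qed
      moreover have "dim_vec (preact H x (l - 1)) = n (l - 1)"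
        by (rule carrier_vecD[OF preact_carrier[OF H(1)]]) (use l in auto)
      moreover have "dim_vec (preact (H' t) (x' t) (l - 1)) = n (l - 1)"
        by (rule carrier_vecD[OF preact_carrier[OF H'(1)]]) (use l in auto)
      ultimately show ?thesis
        by (intro eq_matI) (simp_all add: relu_mask_def mat_diag_def)
    qed
    ultimately show "off_kinks L (H' t) (x' t) \<and> same_masks L (H' t) (x' t) (relu_mask H x)"
      by (simp add: same_masks_def)
  qed
qed

section \<open>Single-entry perturbations and the Jacobian in the input\<close>

lemma update_vec_tendsto:
  fixes x :: "real vec"
  assumes "j < dim_vec x" "k < dim_vec x"
  shows "((\<lambda>t. update_vec x j t $ k) \<longlongrightarrow> x $ k) (nhds (x $ j))"
  using assms by (cases "k = j") (auto simp: filterlim_ident)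

lemma update_mat_tendsto:
  fixes A :: "real mat"
  assumes "a < dim_row A" "b < dim_col A" "p < dim_row A" "q < dim_col A"
  shows "((\<lambda>t. update_mat A (a, b) t $$ (p, q)) \<longlongrightarrow> A $$ (p, q)) (nhds (A $$ (a, b)))"
  using assms by (cases "(p, q) = (a, b)") (auto simp: filterlim_ident)

text \<open>The filter is \<open>nhds\<close> rather than \<open>at\<close>, because
  \<open>DERIV_cong_ev\<close> requires agreement at the base point as well.\<close>

lemma off_kinks_stable_input:
  assumes "layer_dims L n H" "x \<in> carrier_vec (n 0)" "off_kinks L H x" "j < n 0"
  shows "\<forall>\<^sub>F t in nhds (x $ j).
    off_kinks L H (update_vec x j t) \<and> same_masks L H (update_vec x j t) (relu_mask H x)"
proof (rule off_kinks_stable[OF assms(1-3,1)])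
  have dim: "dim_vec x = n 0" using assms(2) by (rule carrier_vecD)
  show "update_vec x j t \<in> carrier_vec (n 0)" for t
    by (rule carrier_vecI) (simp add: dim)
  show "((\<lambda>t. update_vec x j t $ k) \<longlongrightarrow> x $ k) (nhds (x $ j))" if "k < n 0" for k
    using that assms(4) by (intro update_vec_tendsto) (simp_all add: dim)
qed (rule tendsto_const)

text \<open>Near \<open>x\<close> the network agrees along each coordinate line with one fixed
  linear map, whose matrix entry is the derivative.\<close>

lemma mlp_has_derivative:
  assumes "layer_dims L n H" "x \<in> carrier_vec (n 0)" "off_kinks L H x" "1 \<le> L"
    and "same_masks L H x G" "i < n L" "j < n 0"
  shows "((\<lambda>t. mlp L H (update_vec x j t) $ i) has_real_derivative
    (H L * lower_prod G H (n 0) (L - 1)) $$ (i, j)) (at (x $ j))"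
proof -
  let ?A = "H L * lower_prod G H (n 0) (L - 1)"
  have GD: "mask_dims L n G"
    using relu_mask_dims[OF assms(1), of x] assms(5) by (simp add: mask_dims_def same_masks_def)
  have A: "?A \<in> carrier_mat (n L) (n 0)"
    by (rule mult_carrier_mat[OF layer_dimsD[OF assms(1,4) order_refl]
          lower_prod_carrier[OF assms(1) GD]]) (use assms(4) in simp)
  have upd: "update_vec x j t \<in> carrier_vec (n 0)" for t
    by (rule carrier_vecI) (simp add: carrier_vecD[OF assms(2)])
  from off_kinks_stable_input[OF assms(1-3,7)]
  have ev: "\<forall>\<^sub>F t in nhds (x $ j).
      (\<Sum>k<n 0. ?A $$ (i, k) * update_vec x j t $ k) = mlp L H (update_vec x j t) $ i"
  proof (rule eventually_mono)
    fix t
    assume "off_kinks L H (update_vec x j t) \<and> same_masks L H (update_vec x j t) (relu_mask H x)"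
    then have "same_masks L H (update_vec x j t) G" using assms(5) by (simp add: same_masks_def)
    from mlp_eq_lower_prod[OF assms(1) this upd assms(4)]
    show "(\<Sum>k<n 0. ?A $$ (i, k) * update_vec x j t $ k) = mlp L H (update_vec x j t) $ i"
      by (simp only: mult_mat_vec_index[OF A upd assms(6)])
  qed
  have "((\<lambda>t. update_vec x j t $ k) has_real_derivative (if k = j then 1 else 0)) (at (x $ j))"
    if "k < n 0" for k
    using that assms(2,7) by (cases "k = j") (auto intro!: derivative_eq_intros)
  then have der: "((\<lambda>t. \<Sum>k<n 0. ?A $$ (i, k) * update_vec x j t $ k) has_real_derivative
      (\<Sum>k<n 0. ?A $$ (i, k) * (if k = j then 1 else 0))) (at (x $ j))"
    by (intro DERIV_sum DERIV_cmult) auto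
  have "(\<Sum>k<n 0. ?A $$ (i, k) * (if k = j then 1 else 0)) = ?A $$ (i, j)"
    using sum.delta'[of "{..<n 0}" j "\<lambda>k. ?A $$ (i, k)"] assms(7)
    by (simp add: mult_delta_right del: index_mult_mat(1))
  with iffD1[OF DERIV_cong_ev[OF refl ev refl] der] show ?thesis
    by (simp only:)
qed

lemma mlp_has_partials:
  assumes "layer_dims L n H" "x \<in> carrier_vec (n 0)" "off_kinks L H x" "1 \<le> L"
  shows "has_partials (mlp L H) (n L) x"
  unfolding has_partials_def carrier_vecD[OF assms(2)]
proof (intro allI impI)
  fix i j assume "i < n L" "j < n 0"
  moreover have "same_masks L H x (relu_mask H x)" by (simp add: same_masks_def)
  ultimately show "(\<lambda>t. mlp L H (update_vec x j t) $ i) differentiable at (x $ j)"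
    unfolding real_differentiable_def using mlp_has_derivative[OF assms] by blast
qed

text \<open>Keeping \<open>G\<close> general allows the formula to be used at perturbed weights or
  inputs with the masks of the base point.\<close>

lemma jacobian_mlp:
  assumes "layer_dims L n H" "x \<in> carrier_vec (n 0)" "off_kinks L H x" "1 \<le> L"
    and "same_masks L H x G" "i < n L" "j < n 0"
  shows "jacobian (mlp L H) (n L) x $$ (i, j) = (H L * lower_prod G H (n 0) (L - 1)) $$ (i, j)"
  using DERIV_imp_deriv[OF mlp_has_derivative[OF assms]] carrier_vecD[OF assms(2)] assms(6,7)
  by (simp add: jacobian_def del: index_mult_mat(1))

section \<open>Derivative of the Jacobian in a weight\<close>

lemma off_kinks_stable_weight:
  assumes "layer_dims L n H" "x \<in> carrier_vec (n 0)" "off_kinks L H x"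
    and "1 \<le> l" "l \<le> L" "a < n l" "b < n (l - 1)"
  shows "\<forall>\<^sub>F t in nhds (H l $$ (a, b)).
    off_kinks L (H(l := update_mat (H l) (a, b) t)) x \<and>
    same_masks L (H(l := update_mat (H l) (a, b) t)) x (relu_mask H x)"
proof (rule off_kinks_stable[OF assms(1-3) _ assms(2)])
  show "layer_dims L n (H(l := update_mat (H l) (a, b) t))" for t
    by (rule layer_dims_update[OF assms(1)])
next
  fix l' p q assume "1 \<le> l'" "l' \<le> L" "p < n l'" "q < n (l' - 1)"
  then show "((\<lambda>t. (H(l := update_mat (H l) (a, b) t)) l' $$ (p, q)) \<longlongrightarrow> H l' $$ (p, q))
      (nhds (H l $$ (a, b)))"
    using layer_dimsD[OF assms(1,4,5)] assms(6,7) update_mat_tendsto[of a "H l" b p q]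
    by (cases "l' = l") auto
qed auto

text \<open>Only the term at \<open>(a, b)\<close> of the double sum varies with \<open>t\<close>,
  leaving \<open>S\<close> at \<open>a\<close> times \<open>P\<close> at \<open>b\<close>. As
  \<open>P S\<close> has the shape of the transpose of \<open>H l\<close>, its index is
  \<open>(b, a)\<close>.\<close>

lemma jacobian_weight_derivative:
  assumes "layer_dims L n H" "x \<in> carrier_vec (n 0)" "off_kinks L H x"
    and "1 \<le> l" "l \<le> L" "a < n l" "b < n (l - 1)" "i < n L" "j < n 0"
  shows "((\<lambda>t. jacobian (mlp L (H(l := update_mat (H l) (a, b) t))) (n L) x $$ (i, j))
    has_real_derivative (prefix_col H x j l * suffix_row L H x i l) $$ (b, a)) (at (H l $$ (a, b)))"
proof -
  let ?G = "relu_mask H x"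
  let ?H = "\<lambda>t. H(l := update_mat (H l) (a, b) t)"
  let ?S = "upper_row L (n L) ?G H i (L - l)" and ?C = "lower_prod ?G H (n 0) (l - 1)"
  have GD: "mask_dims L n ?G" by (rule relu_mask_dims[OF assms(1)])
  have HD: "layer_dims L n (?H t)" for t by (rule layer_dims_update[OF assms(1)])
  have Hl: "H l \<in> carrier_mat (n l) (n (l - 1))" by (rule layer_dimsD[OF assms(1,4,5)])
  have S: "?S \<in> carrier_mat 1 (n l)"
    using upper_row_carrier[OF assms(1) GD, of "L - l"] assms by simp
  \<comment> \<open>The perturbed network is again off the kinks with unchanged masks, so its
    Jacobian is the same double sum with a single entry replaced by \<open>t\<close>.\<close>
  have ev: "\<forall>\<^sub>F t in nhds (H l $$ (a, b)).
      (\<Sum>q<n (l - 1). (\<Sum>p<n l. ?S $$ (0, p) * update_mat (H l) (a, b) t $$ (p, q)) * ?C $$ (q, j)) =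
      jacobian (mlp L (?H t)) (n L) x $$ (i, j)"
    using off_kinks_stable_weight[OF assms(1-7)]
  proof (rule eventually_mono)
    fix t assume t: "off_kinks L (?H t) x \<and> same_masks L (?H t) x ?G"
    have "upper_row L (n L) ?G (?H t) i (L - l) = ?S"
      using assms(4,5) by (intro upper_row_cong) auto
    moreover have "lower_prod ?G (?H t) (n 0) (l - 1) = ?C"
      using assms(4) by (intro lower_prod_cong) auto
    moreover have "jacobian (mlp L (?H t)) (n L) x $$ (i, j) =
        (?H t L * lower_prod ?G (?H t) (n 0) (L - 1)) $$ (i, j)"
      using t assms(4,5,8,9) by (intro jacobian_mlp[OF HD assms(2)]) simp_all
    ultimately show "(\<Sum>q<n (l - 1). (\<Sum>p<n l. ?S $$ (0, p) * update_mat (H l) (a, b) t $$ (p, q)) * ?C $$ (q, j)) =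
        jacobian (mlp L (?H t)) (n L) x $$ (i, j)"
      by (simp only: upper_row_mult_index[OF HD GD assms(4,5,8,9)] fun_upd_same)
  qed
  have "((\<lambda>t. update_mat (H l) (a, b) t $$ (p, q)) has_real_derivative
      (if p = a then if q = b then 1 else 0 else 0)) (at (H l $$ (a, b)))"
    if "p < n l" "q < n (l - 1)" for p q
    using that Hl assms(6,7) by (cases "(p, q) = (a, b)") (auto intro!: derivative_eq_intros)
  then have der: "((\<lambda>t. \<Sum>q<n (l - 1). (\<Sum>p<n l. ?S $$ (0, p) * update_mat (H l) (a, b) t $$ (p, q)) * ?C $$ (q, j))
      has_real_derivative (\<Sum>q<n (l - 1). (\<Sum>p<n l. ?S $$ (0, p) *
        (if p = a then if q = b then 1 else 0 else 0)) * ?C $$ (q, j))) (at (H l $$ (a, b)))"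
    by (intro DERIV_sum DERIV_cmult DERIV_cmult_right) auto
  have "(\<Sum>q<n (l - 1). (\<Sum>p<n l. ?S $$ (0, p) *
        (if p = a then if q = b then 1 else 0 else 0)) * ?C $$ (q, j)) = ?S $$ (0, a) * ?C $$ (b, j)"
    using assms(6,7) by (simp add: mult_delta_left mult_delta_right)
  \<comment> \<open>A one-column matrix times a one-row matrix: each entry is a single
    product.\<close>
  also have "\<dots> = (prefix_col H x j l * suffix_row L H x i l) $$ (b, a)"
    using prefix_col_index[OF assms(1,2,4,5,9)] S assms(6,7)
    by (simp add: suffix_row_eq[OF assms(1,4,5,8)] scalar_prod_def)
  finally show ?thesis
    using iffD1[OF DERIV_cong_ev[OF refl ev refl] der] by (simp only:)
qed

text \<open>The \<open>has_partials\<close> clauses ensure that the entries of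
  \<open>jacobian\<close> being differentiated are true partial derivatives at all nearby parameter
  values, not arbitrary values of the total function \<open>deriv\<close>.\<close>

theorem theorem1:
  fixes L d :: nat and n :: "nat \<Rightarrow> nat" and H :: "nat \<Rightarrow> real mat" and x :: "real vec"
  assumes "L \<ge> 1" and "n 0 = d"
    and "\<And>l. l \<in> {1..L} \<Longrightarrow> H l \<in> carrier_mat (n l) (n (l - 1))"
    and "x \<in> carrier_vec d"
    and "off_kinks L H x"
  shows
    "(\<forall>l\<in>{1..L}.
        (\<forall>a<n l. \<forall>b<n (l - 1). \<forall>\<^sub>F t in nhds (H l $$ (a, b)).
           has_partials (mlp L (H(l := update_mat (H l) (a, b) t))) (n L) x) \<and>
        (\<forall>i<n L. \<forall>j<d.
           has_mat_partials (\<lambda>M. jacobian (mlp L (H(l := M))) (n L) x $$ (i, j))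
             (transpose_mat (prefix_col H x j l * suffix_row L H x i l)) (H l)))
     \<and> (\<forall>k<d.
        (\<forall>\<^sub>F t in nhds (x $ k). has_partials (mlp L H) (n L) (update_vec x k t)) \<and>
        (\<forall>i<n L. \<forall>j<d.
           ((\<lambda>t. jacobian (mlp L H) (n L) (update_vec x k t) $$ (i, j)) has_real_derivative 0)
             (at (x $ k))))"
proof -
  have dims: "layer_dims L n H" using assms(3) by (simp add: layer_dims_def)
  have x: "x \<in> carrier_vec (n 0)" using assms(2,4) by simp
  have GD: "mask_dims L n (relu_mask H x)" by (rule relu_mask_dims[OF dims])
  show ?thesis
  proof (intro conjI ballI allI impI)
    fix l a b assume l: "l \<in> {1..L}" and a: "a < n l" and b: "b < n (l - 1)"
    have "\<forall>\<^sub>F t in nhds (H l $$ (a, b)).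
        off_kinks L (H(l := update_mat (H l) (a, b) t)) x \<and>
        same_masks L (H(l := update_mat (H l) (a, b) t)) x (relu_mask H x)"
      using l by (intro off_kinks_stable_weight[OF dims x assms(5) _ _ a b]) simp_all
    then show "\<forall>\<^sub>F t in nhds (H l $$ (a, b)).
        has_partials (mlp L (H(l := update_mat (H l) (a, b) t))) (n L) x"
      by (rule eventually_mono) (blast intro: mlp_has_partials[OF layer_dims_update[OF dims] x] assms(1))
  next
    fix l i j assume l: "l \<in> {1..L}" and i: "i < n L" and j: "j < d"
    have Hl: "H l \<in> carrier_mat (n l) (n (l - 1))" using assms(3) l .
    have P: "prefix_col H x j l \<in> carrier_mat (n (l - 1)) 1"
      using prefix_col_index(1)[OF dims x, of l j] l j assms(2) by simp
    have S: "suffix_row L H x i l \<in> carrier_mat 1 (n l)"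
      using suffix_row_eq[OF dims, of l i x] upper_row_carrier[OF dims GD, of "L - l" i] l i by simp
    show "has_mat_partials (\<lambda>M. jacobian (mlp L (H(l := M))) (n L) x $$ (i, j))
        (transpose_mat (prefix_col H x j l * suffix_row L H x i l)) (H l)"
      unfolding has_mat_partials_def carrier_matD[OF Hl]
    proof (intro conjI allI impI)
      show "transpose_mat (prefix_col H x j l * suffix_row L H x i l) \<in> carrier_mat (n l) (n (l - 1))"
        using P S by simp
      fix a b assume a: "a < n l" and b: "b < n (l - 1)"
      have "transpose_mat (prefix_col H x j l * suffix_row L H x i l) $$ (a, b) =
          (prefix_col H x j l * suffix_row L H x i l) $$ (b, a)"
        using P S a b by (simp del: index_mult_mat(1))
      then show "((\<lambda>t. jacobian (mlp L (H(l := update_mat (H l) (a, b) t))) (n L) x $$ (i, j))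
          has_real_derivative transpose_mat (prefix_col H x j l * suffix_row L H x i l) $$ (a, b))
          (at (H l $$ (a, b)))"
        using jacobian_weight_derivative[OF dims x assms(5) _ _ a b i, of j] l j assms(2)
        by (simp del: index_mult_mat(1))
    qed
  next
    fix k assume k: "k < d"
    have upd: "update_vec x k t \<in> carrier_vec (n 0)" for t
      by (rule carrier_vecI) (simp add: carrier_vecD[OF x])
    have ev: "\<forall>\<^sub>F t in nhds (x $ k). off_kinks L H (update_vec x k t) \<and>
        same_masks L H (update_vec x k t) (relu_mask H x)"
      using off_kinks_stable_input[OF dims x assms(5)] k assms(2) by simp
    then show "\<forall>\<^sub>F t in nhds (x $ k). has_partials (mlp L H) (n L) (update_vec x k t)"
      by (rule eventually_mono) (blast intro: mlp_has_partials[OF dims upd] assms(1))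
    fix i j assume i: "i < n L" and j: "j < d"
    \<comment> \<open>The right-hand side is free of \<open>t\<close>: the Jacobian is locally
      constant in the input, hence the zero second derivative.\<close>
    have "\<forall>\<^sub>F t in nhds (x $ k). jacobian (mlp L H) (n L) (update_vec x k t) $$ (i, j) =
        (H L * lower_prod (relu_mask H x) H (n 0) (L - 1)) $$ (i, j)"
      using ev
    proof (rule eventually_mono)
      fix t assume t: "off_kinks L H (update_vec x k t) \<and>
          same_masks L H (update_vec x k t) (relu_mask H x)"
      show "jacobian (mlp L H) (n L) (update_vec x k t) $$ (i, j) =
          (H L * lower_prod (relu_mask H x) H (n 0) (L - 1)) $$ (i, j)"
        by (rule jacobian_mlp[OF dims upd _ assms(1) _ i]) (use t j assms(2) in simp_all)
    qed
    from DERIV_cong_ev[OF refl this refl]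
    show "((\<lambda>t. jacobian (mlp L H) (n L) (update_vec x k t) $$ (i, j)) has_real_derivative 0)
        (at (x $ k))"
      by simp
  qed
qed

end
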